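(* Let $\mathcal{E}=(E,\mathcal{L})$ be a finite left-resolving and predecessor-separated labelled graph over the alphabet $\mathcal{A}$, let $S$ be a subset of the power set $\mathcal{P}(E^0)$, let $\sim$ be an equivalence relation on $S$, and suppose that $(S,\sim)$ is past closed. If $[V]\in S/{\sim}$ receives $a\in\mathcal{A}$, then $|[aV]|\leq|[V]|$. If $\mathcal{G}(\mathcal{E},S,\sim)$ has an edge from a vertex in the $m$th layer to a vertex in the $n$th layer, then $m\leq n$.
   Context: A labelled graph $(E,\mathcal{L})$ over a finite alphabet $\mathcal{A}$ is a directed graph $E=(E^0,E^1,r,s)$ (edge $e$ goes from $s(e)$ to $r(e)$) with a surjective labelling $\mathcal{L}\colon E^1\to\mathcal{A}$. It presents the shift space consisting of the label sequences of its bi-infinite paths. It is left-resolving if no vertex receives two edges with the same label. For $v\in E^0$, $P_\infty^E(v)$ is the set of left-rays of the presented shift which are label sequences of left-infinite paths terminating at $v$; the graph is predecessor-separated if $P^E_\infty(u)\ne P^E_\infty(v)$ whenever $u\neq v$. For $V\subseteq E^0$ and a word $w$ over $\mathcal{A}$, let $wV=\{u\in E^0 : u \text{ is the source of a path labelled } w \text{ terminating in } V\}$. Let $S\subseteq\mathcal{P}(E^0)$ and let $\sim$ be an equivalence relation on $S$. The pair $(S,\sim)$ is past closed if for all $u,v\in E^0$, $U,V\in S$ and $a\in\mathcal{A}$: (1) $\{v\}\in S$; (2) $\{u\}\sim\{v\}$ implies $u=v$; (3) $aV\neq\emptyset$ implies $aV\in S$; (4) $U\sim V$ and $aU\neq\emptyset$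 imply $aV\neq\emptyset$ and $aU\sim aV$. Let $(S,\sim)$ be past closed. Write $[V]$ for the $\sim$-class of $V\in S$. $[V]$ receives $a\in\mathcal{A}$ if $aV\neq\emptyset$. Put $|[V]|=\min_{U\in[V]}|U|$. $\mathcal{G}(\mathcal{E},S,\sim)$ is the labelled graph with vertex set $S/{\sim}$ which has an edge labelled $a$ from $[aV]$ to $[V]$ whenever $[V]$ receives $a$. For $n\in\mathbb{N}$, the $n$th layer of $\mathcal{G}(\mathcal{E},S,\sim)$ is the labelled subgraph induced by $\{[V]\in S/{\sim} : |[V]|=n\}$ (these vertices and all edges between them). *)

theory Defs
  imports "Graph_Theory.Digraph_Component" "Graph_Theory.Arc_Walk"
begin

text \<open>
  A labelled graph over \<open>A\<close> is given by a digraph \<open>E\<close> (an arc \<open>e\<close> goes from \<open>tail E e\<close> to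
  \<open>head E e\<close>; parallel arcs and loops are allowed) and a labelling \<open>L\<close> of its arcs, of which
  only the restriction to \<open>arcs E\<close> matters.
\<close>

locale labelled_graph = wf_digraph E
  for E :: "('v, 'e) pre_digraph" +
  fixes L :: "'e \<Rightarrow> 'a" and A :: "'a set"
  assumes finite_alphabet: "finite A"
    and surj_labelling: "L ` arcs E = A"

definition left_resolving :: "('v, 'e) pre_digraph \<Rightarrow> ('e \<Rightarrow> 'a) \<Rightarrow> bool" where
  "left_resolving E L \<longleftrightarrow>
     (\<forall>e \<in> arcs E. \<forall>f \<in> arcs E. head E e = head E f \<and> L e = L f \<longrightarrow> e = f)"

definition presented_shift :: "('v, 'e) pre_digraph \<Rightarrow> ('e \<Rightarrow> 'a) \<Rightarrow> (int \<Rightarrow> 'a) set" where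
  "presented_shift E L =
     {\<lambda>i. L (p i) | p. \<forall>i. p i \<in> arcs E \<and> head E (p i) = tail E (p (i + 1))}"

text \<open>
  Left-infinite sequences are indexed by \<open>nat\<close> from right to left: entry 0 is the rightmost one.
\<close>

definition left_rays :: "(int \<Rightarrow> 'a) set \<Rightarrow> (nat \<Rightarrow> 'a) set" where
  "left_rays X = {\<lambda>n. x (- 1 - int n) | x. x \<in> X}"

definition left_infinite_path :: "('v, 'e) pre_digraph \<Rightarrow> (nat \<Rightarrow> 'e) \<Rightarrow> 'v \<Rightarrow> bool" where
  "left_infinite_path E p v \<longleftrightarrow>
     (\<forall>n. p n \<in> arcs E \<and> head E (p (Suc n)) = tail E (p n)) \<and> head E (p 0) = v"

definition predecessors :: "('v, 'e) pre_digraph \<Rightarrow> ('e \<Rightarrow> 'a) \<Rightarrow> 'v \<Rightarrow> (nat \<Rightarrow> 'a) set" where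
  "predecessors E L v =
     {y \<in> left_rays (presented_shift E L). \<exists>p. left_infinite_path E p v \<and> y = (\<lambda>n. L (p n))}"

definition predecessor_separated :: "('v, 'e) pre_digraph \<Rightarrow> ('e \<Rightarrow> 'a) \<Rightarrow> bool" where
  "predecessor_separated E L \<longleftrightarrow>
     (\<forall>u \<in> verts E. \<forall>v \<in> verts E. u \<noteq> v \<longrightarrow> predecessors E L u \<noteq> predecessors E L v)"

text \<open>\<open>word_pre E L w V\<close> is \<open>wV\<close>; for a letter, \<open>aV\<close> is \<open>word_pre E L [a] V\<close>.\<close>

definition word_pre :: "('v, 'e) pre_digraph \<Rightarrow> ('e \<Rightarrow> 'a) \<Rightarrow> 'a list \<Rightarrow> 'v set \<Rightarrow> 'v set" where
  "word_pre E L w V =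
     {u \<in> verts E. \<exists>p. \<exists>v \<in> V. pre_digraph.awalk E u p v \<and> map L p = w}"

text \<open>
  The relation \<open>R\<close> is meant to satisfy \<open>equiv S R\<close>; the class of \<open>V\<close> is then \<open>R `` {V}\<close>.
\<close>

definition past_closed ::
    "('v, 'e) pre_digraph \<Rightarrow> ('e \<Rightarrow> 'a) \<Rightarrow> 'a set \<Rightarrow> 'v set set \<Rightarrow> ('v set \<times> 'v set) set \<Rightarrow> bool" where
  "past_closed E L A S R \<longleftrightarrow>
     (\<forall>v \<in> verts E. {v} \<in> S) \<and>
     (\<forall>u \<in> verts E. \<forall>v \<in> verts E. ({u}, {v}) \<in> R \<longrightarrow> u = v) \<and>
     (\<forall>V \<in> S. \<forall>a \<in> A. word_pre E L [a] V \<noteq> {} \<longrightarrow> word_pre E L [a] V \<in> S) \<and>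
     (\<forall>U \<in> S. \<forall>V \<in> S. \<forall>a \<in> A. (U, V) \<in> R \<and> word_pre E L [a] U \<noteq> {} \<longrightarrow>
        word_pre E L [a] V \<noteq> {} \<and> (word_pre E L [a] U, word_pre E L [a] V) \<in> R)"

definition receives :: "('v, 'e) pre_digraph \<Rightarrow> ('e \<Rightarrow> 'a) \<Rightarrow> 'v set set \<Rightarrow> 'a \<Rightarrow> bool" where
  "receives E L C a \<longleftrightarrow> (\<exists>V \<in> C. word_pre E L [a] V \<noteq> {})"

text \<open>The choice of the representative in \<^const>\<open>receives\<close> is immaterial.\<close>

lemma receives_class_iff:
  assumes "equiv S R" and "past_closed E L A S R" and "V \<in> S" and "a \<in> A"
  shows "receives E L (R `` {V}) a \<longleftrightarrow> word_pre E L [a] V \<noteq> {}"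
proof
  assume "receives E L (R `` {V}) a"
  then obtain U where U: "(V, U) \<in> R" "word_pre E L [a] U \<noteq> {}"
    by (auto simp: receives_def)
  have "(U, V) \<in> R" using assms(1) U(1) by (auto simp: equiv_def sym_def)
  moreover have "U \<in> S" using assms(1) U(1) by (auto simp: equiv_def refl_on_def)
  ultimately show "word_pre E L [a] V \<noteq> {}"
    using assms(2-4) U(2) unfolding past_closed_def by blast
next
  assume "word_pre E L [a] V \<noteq> {}"
  moreover have "V \<in> R `` {V}" using assms(1,3) by (rule equiv_class_self)
  ultimately show "receives E L (R `` {V}) a" unfolding receives_def by blast
qed

definition class_card :: "'v set set \<Rightarrow> nat" where
  "class_card C = (MIN U\<in>C. card U)"

text \<open>
  In the labelled graph on \<open>S // R\<close>, the arc labelled \<open>a\<close> from \<open>C\<close> to \<open>D\<close> is the triple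
  \<open>(C, a, D)\<close>. If \<open>(S, R)\<close> is past closed, a class receives at most one arc with
  a given label, so no multiplicities are lost.
\<close>

definition past_graph ::
    "('v, 'e) pre_digraph \<Rightarrow> ('e \<Rightarrow> 'a) \<Rightarrow> 'a set \<Rightarrow> 'v set set \<Rightarrow> ('v set \<times> 'v set) set \<Rightarrow>
     ('v set set, 'v set set \<times> 'a \<times> 'v set set) pre_digraph" where
  "past_graph E L A S R =
     \<lparr> verts = S // R,
       arcs = {(R `` {word_pre E L [a] V}, a, R `` {V}) | V a.
                 V \<in> S \<and> a \<in> A \<and> receives E L (R `` {V}) a},
       tail = \<lambda>(C, a, D). C,
       head = \<lambda>(C, a, D). D \<rparr>"

definition past_label :: "'v set set \<times> 'a \<times> 'v set set \<Rightarrow> 'a" where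
  "past_label = (\<lambda>(C, a, D). a)"

text \<open>Layers carry the labelling \<^const>\<open>past_label\<close> of the whole graph.\<close>

definition layer ::
    "('v, 'e) pre_digraph \<Rightarrow> ('e \<Rightarrow> 'a) \<Rightarrow> 'a set \<Rightarrow> 'v set set \<Rightarrow> ('v set \<times> 'v set) set \<Rightarrow> nat \<Rightarrow>
     ('v set set, 'v set set \<times> 'a \<times> 'v set set) pre_digraph" where
  "layer E L A S R n =
     induce_subgraph (past_graph E L A S R)
       {C \<in> verts (past_graph E L A S R). class_card C = n}"

lemma labelled_graph_past_graph:
  assumes "labelled_graph E L A" and "equiv S R" and "past_closed E L A S R"
  shows "labelled_graph (past_graph E L A S R) past_label A"
proof -
  interpret labelled_graph E L A by fact
  show ?thesis
  proof
    fix e assume "e \<in> arcs (past_graph E L A S R)"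
    then obtain V a where e: "e = (R `` {word_pre E L [a] V}, a, R `` {V})"
      and V: "V \<in> S" "a \<in> A" "receives E L (R `` {V}) a"
      by (auto simp: past_graph_def)
    have "word_pre E L [a] V \<in> S"
      using receives_class_iff[OF assms(2,3) V(1,2)] V assms(3)
      unfolding past_closed_def by blast
    then show "tail (past_graph E L A S R) e \<in> verts (past_graph E L A S R)"
      and "head (past_graph E L A S R) e \<in> verts (past_graph E L A S R)"
      using V(1) by (auto simp: e past_graph_def intro: quotientI)
  next
    show "finite A" by (rule finite_alphabet)
  next
    have "a \<in> past_label ` arcs (past_graph E L A S R)" if a: "a \<in> A" for a
    proof -
      obtain e where e: "e \<in> arcs E" "L e = a" using a surj_labelling by blast
      have S: "{head E e} \<in> S" using assms(3) e(1) unfolding past_closed_def by simp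
      have "pre_digraph.awalk E (tail E e) [e] (head E e)"
        using e(1) by (simp add: pre_digraph.awalk_def pre_digraph.cas.simps)
      moreover have "map L [e] = [a]" using e(2) by simp
      ultimately have "tail E e \<in> word_pre E L [a] {head E e}"
        using e(1) unfolding word_pre_def
        by (intro CollectI conjI exI[of _ "[e]"] bexI[of _ "head E e"]) simp_all
      then have "receives E L (R `` {{head E e}}) a"
        using receives_class_iff[OF assms(2,3) S a] by blast
      then have "(R `` {word_pre E L [a] {head E e}}, a, R `` {{head E e}})
          \<in> arcs (past_graph E L A S R)"
        using S a unfolding past_graph_def by auto
      then show ?thesis by (rule rev_image_eqI) (simp add: past_label_def)
    qed
    then show "past_label ` arcs (past_graph E L A S R) = A"
      by (auto simp: past_graph_def past_label_def)
  qed
qed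

end

theory Submission
  imports Defs
begin

text \<open>
  In a left-resolving graph a vertex \<open>v\<close> receives at most one arc labelled \<open>a\<close>, so
  \<open>v\<close> contributes at most one source to \<open>aV\<close>, and \<open>|aV| \<le> |V|\<close> for every finite \<open>V\<close>.
  To pass from sets to classes, take a set \<open>U\<close> of least size in the class of \<open>V\<close>. As the relation
  is compatible with \<open>a\<close>, the set \<open>aU\<close> lies in the class of \<open>aV\<close>, so that
  \<open>|[aV]| \<le> |aU| \<le> |U| = |[V]|\<close>. The assertion on layers is the same inequality, because
  the arcs of the past graph are exactly those from \<open>[aV]\<close> to a class \<open>[V]\<close> that
  receives \<open>a\<close>.
\<close>

lemma word_pre_letter:
  "word_pre E L [a] V = {u \<in> verts E. \<exists>e \<in> arcs E. tail E e = u \<and> head E e \<in> V \<and> L e = a}"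
proof -
  have "pre_digraph.awalk E u [e] v \<longleftrightarrow>
      u \<in> verts E \<and> e \<in> arcs E \<and> tail E e = u \<and> head E e = v" for u e v
    by (auto simp: pre_digraph.awalk_def pre_digraph.cas.simps)
  then show ?thesis
    unfolding word_pre_def by (auto simp: map_eq_Cons_conv intro!: exI[of _ "[_]"])
qed

text \<open>
  Left-resolving makes the head of an arc labelled \<open>a\<close> determine the arc, so among the arcs
  labelled \<open>a\<close> that end in \<open>V\<close> heads are distinct; taking tails covers \<open>aV\<close>.
\<close>

lemma card_word_pre_letter_le:
  assumes "left_resolving E L" and "finite V"
  shows "card (word_pre E L [a] V) \<le> card V"
proof -
  let ?F = "{e \<in> arcs E. head E e \<in> V \<and> L e = a}"
  have inj: "inj_on (head E) ?F"
    using assms(1) unfolding left_resolving_def inj_on_def by blast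
  have sub: "head E ` ?F \<subseteq> V" by blast
  have fin: "finite ?F"
    using finite_subset[OF sub assms(2)] inj by (rule finite_imageD)
  have "card (word_pre E L [a] V) \<le> card (tail E ` ?F)"
    using fin by (intro card_mono finite_imageI) (auto simp: word_pre_letter)
  also have "\<dots> \<le> card ?F" using fin by (rule card_image_le)
  also have "\<dots> \<le> card V" using inj sub assms(2) by (rule card_inj_on_le)
  finally show ?thesis .
qed

lemma class_card_le:
  assumes "finite C" and "U \<in> C"
  shows "class_card C \<le> card U"
  unfolding class_card_def using assms by (intro Min_le) auto

lemma class_card_attained:
  assumes "finite C" and "C \<noteq> {}"
  obtains U where "U \<in> C" and "class_card C = card U"
proof -
  have "class_card C \<in> card ` C"
    unfolding class_card_def using assms by (intro Min_in) auto
  then show thesis using that by blast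
qed

lemma class_card_word_pre_le:
  assumes "left_resolving E L" and "finite (verts E)" and "S \<subseteq> Pow (verts E)"
    and "equiv S R" and "past_closed E L A S R"
    and "V \<in> S" and "a \<in> A" and "receives E L (R `` {V}) a"
  shows "class_card (R `` {word_pre E L [a] V}) \<le> class_card (R `` {V})"
proof -
  have finS: "finite S" using assms(2,3) by (auto intro: finite_subset)
  have sub: "R \<subseteq> S \<times> S" using assms(4) by (auto simp: equiv_def refl_on_def)
  have fin: "finite (R `` {W})" for W
    using sub finS by (auto intro: finite_subset[of _ S])
  have "R `` {V} \<noteq> {}" using equiv_class_self[OF assms(4,6)] by blast
  then obtain U where U: "U \<in> R `` {V}" "class_card (R `` {V}) = card U"
    using class_card_attained[OF fin] by metis
  have US: "U \<in> S" "(V, U) \<in> R" using U(1) sub by auto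
  have "word_pre E L [a] V \<noteq> {}"
    using receives_class_iff[OF assms(4-7)] assms(8) by blast
  then have "(word_pre E L [a] V, word_pre E L [a] U) \<in> R"
    using assms(5-7) US unfolding past_closed_def by blast
  then have "class_card (R `` {word_pre E L [a] V}) \<le> card (word_pre E L [a] U)"
    by (intro class_card_le fin) blast
  also have "\<dots> \<le> card U"
    using US(1) assms(2,3) by (intro card_word_pre_letter_le[OF assms(1)]) (auto intro: finite_subset)
  finally show ?thesis using U(2) by simp
qed

theorem proposition4p4:
  fixes E :: "('v, 'e) pre_digraph" and L :: "'e \<Rightarrow> 'a" and A :: "'a set"
    and S :: "'v set set" and R :: "('v set \<times> 'v set) set"
  assumes "labelled_graph E L A" and "fin_digraph E"
    and "left_resolving E L" and "predecessor_separated E L"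
    and "S \<subseteq> Pow (verts E)" and "equiv S R" and "past_closed E L A S R"
  shows "(\<forall>V \<in> S. \<forall>a \<in> A. receives E L (R `` {V}) a \<longrightarrow>
            class_card (R `` {word_pre E L [a] V}) \<le> class_card (R `` {V})) \<and>
         (\<forall>m n. \<forall>e \<in> arcs (past_graph E L A S R).
            tail (past_graph E L A S R) e \<in> verts (layer E L A S R m) \<and>
            head (past_graph E L A S R) e \<in> verts (layer E L A S R n) \<longrightarrow> m \<le> n)"
proof -
  have "finite (verts E)" using assms(2) by (rule fin_digraph.finite_verts)
  note le = class_card_word_pre_le[OF assms(3) this assms(5-7)]
  have layer: "C \<in> verts (layer E L A S R n) \<Longrightarrow> class_card C = n" for C n
    by (simp add: layer_def induce_subgraph_def)
  show ?thesis
  proof (intro conjI allI ballI impI)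
    fix m n e
    assume "e \<in> arcs (past_graph E L A S R)"
      and ends: "tail (past_graph E L A S R) e \<in> verts (layer E L A S R m) \<and>
        head (past_graph E L A S R) e \<in> verts (layer E L A S R n)"
    then obtain V a where V: "V \<in> S" "a \<in> A" "receives E L (R `` {V}) a"
      and e: "e = (R `` {word_pre E L [a] V}, a, R `` {V})"
      by (auto simp: past_graph_def)
    have "class_card (R `` {word_pre E L [a] V}) = m" "class_card (R `` {V}) = n"
      using ends by (auto intro!: layer simp: e past_graph_def)
    then show "m \<le> n" using le[OF V] by simp
  qed (rule le)
qed

end
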